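(* Let $m$ be even, $n=2m$, $q=2^m$, $\mathbb{K}=\mathbb{F}_q\subset\mathbb{F}=\mathbb{F}_{2^n}$, $k$ a positive integer with $\gcd(k,n)=1$, and $f_k(X)=X^{2^k+1}+(X+X^q)^{2^k+1}$. For $A\in\mathbb{F}^*$ let $D_Af_k(X)=f_k(X)+f_k(X+A)+f_k(A)$. Let $A=ag$ with $a\in\mathbb{K}^*$ and $g\in\mathcal{T}_1$. Then the image of $D_Af_k$ is the hyperplane $H_{\beta_A}=\{X\in\mathbb{F}:\mathrm{Tr}_{\mathbb{F}/\mathbb{F}_2}(\beta_AX)=0\}$, where $$\beta_A=\frac{1}{a^{2^k+1}}\,\frac{\mathrm{Tr}(g^{2^k+1})}{\mathrm{Tr}(g^3)^{2^k+1}}\left(g+1+\frac{\mathrm{Tr}(g^3)}{\mathrm{Tr}(g^{2^k+1})}\right).$$ Moreover, the hyperplane spectrum $\mathcal{H}_{f_k}$ has constant multiplicity $3$, i.e., every element of $\mathcal{H}_{f_k}$ occurs in it exactly $3$ times.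
   Context: $\mathrm{Tr}(X)=X+X^q$ and $\mathcal{T}_1=\{X\in\mathbb{F}:\mathrm{Tr}(X)=1\}$. Every $A\in\mathbb{F}^*$ can be written uniquely as $A=ag$ with $a\in\mathbb{K}^*$ and $g\in\mathcal{T}_1\cup\{1\}$. For $\beta\in\mathbb{F}^*$, $H_\beta=\{X\in\mathbb{F}:\mathrm{Tr}_{\mathbb{F}/\mathbb{F}_2}(\beta X)=0\}$. For a function $f$ whose derivatives $D_Af$, $A\in\mathbb{F}^*$, each have a hyperplane as image, the hyperplane spectrum $\mathcal{H}_f$ is the multiset $\{\beta\in\mathbb{F}^*:\ \mathrm{Im}(D_Af)=H_\beta\}$ with one entry for each $A\in\mathbb{F}^*$ (for $A=a\in\mathbb{K}^*$ one has $\mathrm{Im}(D_af_k)=H_{1/a^{2^k+1}}$). *)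

theory Defs
  imports Complex_Main "HOL-Library.Multiset"
begin

text \<open>
  The ambient field \<open>\<bbbF>\<close> of order \<open>2 ^ n\<close> is a type of class \<open>{field, finite}\<close> whose cardinality
  is fixed in the theorem; its characteristic is then 2, so that addition and subtraction agree.
\<close>

text \<open>Inside a finite field of order \<open>q ^ 2\<close> this is the unique subfield with \<open>q\<close> elements.\<close>

definition subfield_of_order :: "nat \<Rightarrow> 'a::field set" where
  "subfield_of_order q = {x. x ^ q = x}"

definition rel_trace :: "nat \<Rightarrow> 'a::field \<Rightarrow> 'a" where
  "rel_trace q x = x + x ^ q"

definition trace_one :: "nat \<Rightarrow> 'a::field set" where
  "trace_one q = {x. rel_trace q x = 1}"

text \<open>The trace from the field of order \<open>2 ^ n\<close> to its prime field, with values in \<open>{0, 1}\<close>.\<close>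

definition abs_trace :: "nat \<Rightarrow> 'a::field \<Rightarrow> 'a" where
  "abs_trace n x = (\<Sum>i<n. x ^ (2 ^ i))"

definition hyperplane :: "nat \<Rightarrow> 'a::field \<Rightarrow> 'a set" where
  "hyperplane n \<beta> = {x. abs_trace n (\<beta> * x) = 0}"

definition fk :: "nat \<Rightarrow> nat \<Rightarrow> 'a::field \<Rightarrow> 'a" where
  "fk q k x = x ^ (2 ^ k + 1) + (x + x ^ q) ^ (2 ^ k + 1)"

definition deriv2 :: "('a::field \<Rightarrow> 'a) \<Rightarrow> 'a \<Rightarrow> 'a \<Rightarrow> 'a" where
  "deriv2 f a x = f x + f (x + a) + f a"

definition hyperplane_derivs :: "nat \<Rightarrow> ('a::field \<Rightarrow> 'a) \<Rightarrow> bool" where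
  "hyperplane_derivs n f \<longleftrightarrow>
     (\<forall>a. a \<noteq> 0 \<longrightarrow> (\<exists>!\<beta>. \<beta> \<noteq> 0 \<and> range (deriv2 f a) = hyperplane n \<beta>))"

text \<open>Meaningful only when \<open>hyperplane_derivs n f\<close> holds, so that each \<open>THE\<close> is well defined.\<close>

definition hyperplane_spectrum :: "nat \<Rightarrow> ('a::{field,finite} \<Rightarrow> 'a) \<Rightarrow> 'a multiset" where
  "hyperplane_spectrum n f =
     image_mset (\<lambda>a. THE \<beta>. \<beta> \<noteq> 0 \<and> range (deriv2 f a) = hyperplane n \<beta>) (mset_set (UNIV - {0}))"

definition beta :: "nat \<Rightarrow> nat \<Rightarrow> 'a::field \<Rightarrow> 'a \<Rightarrow> 'a" where
  "beta q k a g =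
     1 / a ^ (2 ^ k + 1)
     * (rel_trace q (g ^ (2 ^ k + 1)) / rel_trace q (g ^ 3) ^ (2 ^ k + 1))
     * (g + 1 + rel_trace q (g ^ 3) / rel_trace q (g ^ (2 ^ k + 1)))"

end

theory Submission
  imports Defs "HOL-Computational_Algebra.Polynomial"
begin

text \<open>
  Write \<open>\<sigma> = 2 ^ k\<close>. For \<open>A = a g\<close>, substituting \<open>X = a Y\<close> gives
  \<open>D\<^sub>A f(X) = a ^ (\<sigma> + 1) Z(Y)\<close>, where
  \<open>Z(Y) = Y ^ \<sigma> g + Y g ^ \<sigma> + Tr(Y) ^ \<sigma> + Tr(Y)\<close> is additive. Put \<open>s = Tr(g ^ (\<sigma> + 1)) = g ^ \<sigma> + g + 1\<close>
  and \<open>c = Tr(g ^ 3) = g ^ 2 + g + 1\<close>; both lie in \<open>K\<close> and satisfy \<open>c ^ \<sigma> = c + s ^ 2 + s\<close>.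
  In the \<open>K\<close>-basis \<open>1, g\<close>, with \<open>Y = u + v g\<close>, this identity shows that \<open>Z\<close> has kernel \<open>{0, g}\<close> and
  that the relative trace of \<open>(s g + s + c) Z(Y) / c ^ (\<sigma> + 1)\<close> is \<open>(u / c) ^ \<sigma> + u / c\<close>, whose
  absolute trace vanishes; counting identifies the image with the hyperplane.

  For the multiplicities, \<open>\<beta> / Tr(\<beta>) = g + 1 + c / s\<close> determines \<open>g\<close>: a collision
  \<open>h = g + r\<close> would give \<open>w = g + c / r\<close> with \<open>w ^ \<sigma> = w + 1\<close>, forcing \<open>w\<close> into the field of
  four elements, which lies in \<open>K\<close> because \<open>m\<close> is even, and hence \<open>g\<close> into \<open>K\<close>. So
  \<open>A\<close> and \<open>B\<close> share a hyperplane iff \<open>(A / B) ^ 3 = 1\<close>.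
\<close>

section \<open>Fixed points of iterated Frobenius maps\<close>

lemma power_two_power_mult_fixed:
  fixes x :: "'a::monoid_mult"
  assumes "x ^ (2 ^ a) = x"
  shows "x ^ (2 ^ (a * i)) = x"
proof (induction i)
  case (Suc i)
  have "x ^ (2 ^ (a * Suc i)) = (x ^ (2 ^ a)) ^ (2 ^ (a * i))"
    by (simp add: power_add power_mult[symmetric])
  then show ?case using assms Suc by simp
qed simp

text \<open>Bezout writes the gcd as \<open>a * i - b * j\<close>. Squaring \<open>a * i\<close>
  times or \<open>b * j\<close> times fixes \<open>x\<close>, and the difference inherits
  this.\<close>

lemma power_two_power_gcd_fixed:
  fixes x :: "'a::monoid_mult"
  assumes "x ^ (2 ^ a) = x" and "x ^ (2 ^ b) = x" and "a \<noteq> 0"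
  shows "x ^ (2 ^ gcd a b) = x"
proof -
  obtain i j where ij: "a * i = b * j + gcd a b"
    using bezout_nat[OF \<open>a \<noteq> 0\<close>] by blast
  have "x = x ^ (2 ^ (b * j + gcd a b))"
    using power_two_power_mult_fixed[OF assms(1), of i] ij by simp
  also have "\<dots> = (x ^ (2 ^ (b * j))) ^ (2 ^ gcd a b)"
    by (simp add: power_add power_mult)
  finally show ?thesis
    using power_two_power_mult_fixed[OF assms(2), of j] by simp
qed

text \<open>Unlike the library's \<open>finite_field_power_card_eq_same\<close>, this does not require the class
  \<open>finite_field\<close>, which the sort \<open>{field, finite}\<close> does not entail.\<close>

lemma finite_field_power_card:
  fixes x :: "'a::{field,finite}"
  shows "x ^ card (UNIV :: 'a set) = x"
proof (cases "x = 0")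
  case False
  have "(\<Prod>y\<in>UNIV-{0}. x * y) = (\<Prod>y\<in>UNIV-{0}. y)"
    by (rule prod.reindex_bij_witness[of _ "\<lambda>y. y / x" "\<lambda>y. x * y"]) (use False in auto)
  moreover have "(\<Prod>y\<in>UNIV-{0}. x * y) = x ^ (card (UNIV :: 'a set) - 1) * \<Prod>(UNIV-{0})"
    by (simp add: prod.distrib)
  moreover have "\<Prod>(UNIV-{0::'a}) \<noteq> 0"
    by simp
  ultimately have "x ^ (card (UNIV :: 'a set) - 1) = 1"
    by simp
  then show ?thesis
    using finite_UNIV_card_ge_0[where ?'a = 'a] by (metis finite power_minus_mult mult_1)
qed (use finite_UNIV_card_ge_0[where ?'a = 'a] in auto)

section \<open>Hyperplanes in finite fields of characteristic two\<close>

locale char2_field =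
  fixes n :: nat and F :: "'a::{field,finite} itself"
  assumes card_F: "card (UNIV :: 'a set) = 2 ^ n" and n_pos: "n > 0"
begin

lemma frobenius_n: "(x :: 'a) ^ (2 ^ n) = x"
  using finite_field_power_card[of x] by (simp add: card_F)

lemma add_self: "(x :: 'a) + x = 0"
proof -
  \<comment> \<open>The exponent \<open>2 ^ n\<close> is even, so
    \<open>- 1 = (- 1) ^ (2 ^ n) = 1\<close>.\<close>
  have "(- 1 :: 'a) = 1"
    using frobenius_n[of "- 1"] n_pos by (simp add: power_minus_even)
  then have "(1::'a) + 1 = 0"
    by (metis add.right_inverse)
  then show ?thesis
    by (metis distrib_left mult.right_neutral mult_zero_right)
qed

lemma add_left_self: "(x :: 'a) + (x + y) = y"
  by (simp add: add_self add.assoc[symmetric])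

lemma minus_eq: "- (x :: 'a) = x"
  using add_self[of x] by (simp add: eq_neg_iff_add_eq_0 minus_equation_iff)

lemma diff_eq: "(x :: 'a) - y = x + y"
  by (metis minus_eq diff_conv_add_uminus)

lemma two_zero: "(2 :: 'a) = 0"
  using add_self[of 1] by simp

lemmas char2_simps = add_self add_left_self minus_eq diff_eq two_zero

lemma add_eq_0: "(x :: 'a) + y = 0 \<longleftrightarrow> x = y"
  by (metis add_left_self add_self add.right_neutral)

lemma add_eq_iff: "(x :: 'a) + y = z \<longleftrightarrow> x = y + z"
  by (metis add_left_self add.commute)

lemma frobenius_add: "((x :: 'a) + y) ^ (2 ^ j) = x ^ (2 ^ j) + y ^ (2 ^ j)"
proof (induction j)
  case (Suc j)
  have "(x + y) ^ (2 ^ Suc j) = ((x + y) ^ 2 ^ j)\<^sup>2"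
    by (metis power_Suc2 power_mult)
  also have "\<dots> = (x ^ 2 ^ j)\<^sup>2 + (y ^ 2 ^ j)\<^sup>2"
    by (simp add: Suc power2_sum two_zero)
  also have "\<dots> = x ^ (2 ^ Suc j) + y ^ (2 ^ Suc j)"
    by (metis power_Suc2 power_mult)
  finally show ?case .
qed simp

lemma idempotent_cases: "(x :: 'a) ^ 2 = x \<Longrightarrow> x = 0 \<or> x = 1"
  by (simp add: power2_eq_square)

lemma abs_trace_add: "abs_trace j (x + y :: 'a) = abs_trace j x + abs_trace j y"
  by (simp add: abs_trace_def frobenius_add sum.distrib)

lemma abs_trace_square: "abs_trace j (x :: 'a) ^ 2 = abs_trace j (x ^ 2)"
  unfolding abs_trace_def
  by (induction j) (simp_all add: power2_sum two_zero power_mult[symmetric] mult.commute)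

text \<open>Squaring shifts the sum by one index, and the term that leaves equals the one that
  enters. The length \<open>j\<close> is free because the trace is needed on the whole field and,
  with \<open>m\<close> terms, on \<open>K\<close>.\<close>

lemma abs_trace_frobenius:
  assumes "(x :: 'a) ^ (2 ^ j) = x"
  shows "abs_trace j (x ^ (2 ^ i)) = abs_trace j x"
proof (induction i)
  case (Suc i)
  let ?y = "x ^ (2 ^ i)"
  have y: "?y ^ (2 ^ j) = ?y"
    by (metis assms power_mult mult.commute)
  have "abs_trace j (x ^ (2 ^ Suc i)) = (\<Sum>l<j. ?y ^ (2 ^ Suc l))"
    by (simp add: abs_trace_def power_mult[symmetric] mult_ac)
  also have "\<dots> + ?y = abs_trace j ?y + ?y ^ (2 ^ j)"
    using sum.lessThan_Suc_shift[of "\<lambda>l. ?y ^ (2 ^ l)" j]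
    by (simp add: abs_trace_def add.commute)
  finally show ?case
    using Suc y by simp
qed simp

text \<open>The trace is a nonzero polynomial of degree at most \<open>2 ^ (n - 1)\<close>, too
  small for \<open>2 ^ n\<close> roots.\<close>

lemma abs_trace_not_identically_zero:
  assumes "(b :: 'a) \<noteq> 0"
  shows "\<exists>x. abs_trace n (b * x) \<noteq> 0"
proof (rule ccontr)
  assume "\<nexists>x. abs_trace n (b * x) \<noteq> 0"
  then have "abs_trace n (b * (y / b)) = 0" for y
    by blast
  then have zero: "abs_trace n y = 0" for y :: 'a
    using assms by simp
  define p :: "'a poly" where "p = (\<Sum>i<n. monom 1 (2 ^ i))"
  have "poly p y = abs_trace n y" for y
    by (simp add: p_def abs_trace_def poly_sum poly_monom)
  then have roots: "{y. poly p y = 0} = UNIV"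
    using zero by auto
  have "coeff p 1 = (\<Sum>i<n. if i = 0 then 1 else 0)"
    unfolding p_def coeff_sum by (intro sum.cong) auto
  also have "\<dots> = 1"
    using n_pos by simp
  finally have "p \<noteq> 0"
    by auto
  have "degree p \<le> 2 ^ (n - 1)"
    unfolding p_def
    by (intro degree_sum_le) (auto intro!: order.trans[OF degree_monom_le] power_increasing)
  moreover have "2 ^ n \<le> degree p"
    using card_poly_roots_bound[OF \<open>p \<noteq> 0\<close>] roots card_F by simp
  ultimately have "(2::nat) ^ n \<le> 2 ^ (n - 1)"
    by (meson order.trans)
  then show False
    using power_strict_increasing[of "n - 1" n "2::nat"] n_pos by simp
qed

text \<open>Traces take only the values 0 and 1, so equal kernels mean equal functionals, and
  multiplication by \<open>b + c\<close> would make every trace vanish.\<close>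

lemma hyperplane_inject:
  assumes "hyperplane n b = hyperplane n (c :: 'a)" and "b \<noteq> 0" "c \<noteq> 0"
  shows "b = c"
proof (rule ccontr)
  assume "b \<noteq> c"
  have tr01: "abs_trace n x = 0 \<or> abs_trace n x = 1" for x :: 'a
  proof -
    have "abs_trace n x ^ 2 = abs_trace n (x ^ 2)"
      by (rule abs_trace_square)
    also have "\<dots> = abs_trace n x"
      using abs_trace_frobenius[OF frobenius_n[of x], of 1] by simp
    finally show ?thesis
      by (rule idempotent_cases)
  qed
  have "abs_trace n ((b + c) * x) = 0" for x
  proof -
    have "abs_trace n (b * x) = 0 \<longleftrightarrow> abs_trace n (c * x) = 0"
      using assms(1) by (auto simp: hyperplane_def)
    then have "abs_trace n (b * x) = abs_trace n (c * x)"
      using tr01 by metis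
    then show ?thesis
      by (simp add: distrib_right abs_trace_add add_self)
  qed
  moreover have "b + c \<noteq> 0"
    using \<open>b \<noteq> c\<close> by (simp add: add_eq_0)
  ultimately show False
    using abs_trace_not_identically_zero by blast
qed

lemma card_hyperplane_le:
  assumes "(b :: 'a) \<noteq> 0"
  shows "2 * card (hyperplane n b) \<le> 2 ^ n"
proof -
  obtain x where x: "abs_trace n (b * x) \<noteq> 0"
    using abs_trace_not_identically_zero[OF assms] by blast
  let ?H = "hyperplane n b"
  have disj: "?H \<inter> (+) x ` ?H = {}"
    using x by (auto simp: hyperplane_def distrib_left abs_trace_add)
  have "2 * card ?H = card (?H \<union> (+) x ` ?H)"
    by (subst card_Un_disjoint) (simp_all add: disj card_image)
  also have "\<dots> \<le> card (UNIV :: 'a set)"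
    by (rule card_mono) auto
  finally show ?thesis
    by (simp add: card_F)
qed

text \<open>Fibres of \<open>L\<close> have at most two elements, so its image has at least half the field; being
  contained in a hyperplane, it fills it.\<close>

lemma range_eq_hyperplane:
  fixes L :: "'a \<Rightarrow> 'a"
  assumes add: "\<And>x y. L (x + y) = L x + L y"
    and ker: "\<And>x. L x = 0 \<Longrightarrow> x = 0 \<or> x = A"
    and tr: "\<And>x. abs_trace n (b * L x) = 0" and "b \<noteq> 0"
  shows "range L = hyperplane n b"
proof (rule card_seteq)
  show "range L \<subseteq> hyperplane n b"
    using tr by (auto simp: hyperplane_def)
  have fibre: "card {x. L x = y} \<le> 2" for y
  proof (cases "\<exists>x. L x = y")
    case True
    then obtain x0 where x0: "L x0 = y" by blast
    have "{x. L x = y} \<subseteq> {x0, x0 + A}"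
    proof
      fix x assume "x \<in> {x. L x = y}"
      then have "L (x + x0) = 0"
        by (simp add: add x0 add_self)
      then have "x + x0 = 0 \<or> x + x0 = A"
        by (rule ker)
      then show "x \<in> {x0, x0 + A}"
        by (auto simp: add_eq_0 add_eq_iff)
    qed
    then have "card {x. L x = y} \<le> card {x0, x0 + A}"
      by (rule card_mono[rotated]) simp
    also have "\<dots> \<le> 2"
      by (simp add: card_insert_if)
    finally show ?thesis .
  qed simp
  have "(UNIV :: 'a set) = (\<Union>y\<in>range L. {x. L x = y})"
    by auto
  then have "2 ^ n \<le> (\<Sum>y\<in>range L. card {x. L x = y})"
    using card_UN_le[of "range L" "\<lambda>y. {x. L x = y}"] by (simp add: card_F)
  also have "\<dots> \<le> (\<Sum>y\<in>range L. 2)"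
    by (intro sum_mono fibre)
  finally have "2 ^ n \<le> 2 * card (range L)"
    by simp
  then show "card (hyperplane n b) \<le> card (range L)"
    using card_hyperplane_le[OF \<open>b \<noteq> 0\<close>] by linarith
qed simp

end


section \<open>The derivatives as hyperplanes\<close>

locale gold_parameters = char2_field "2 * m" F for m :: nat and F :: "'a::{field,finite} itself" +
  fixes k :: nat
  assumes even_m: "even m" and coprime_k: "gcd k (2 * m) = 1"
begin

section \<open>Subfields fixed by powers of Frobenius\<close>

lemma odd_k: "odd k"
proof
  assume "even k"
  then have "2 dvd gcd k (2 * m)"
    by simp
  then show False
    by (simp add: coprime_k)
qed

lemma frobenius_q_q: "((x :: 'a) ^ (2 ^ m)) ^ (2 ^ m) = x"
  using frobenius_n[of x] by (simp add: power_mult[symmetric] power_add[symmetric] mult_2)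

lemma frobenius_k_fixed:
  assumes "(x :: 'a) ^ (2 ^ k) = x"
  shows "x = 0 \<or> x = 1"
proof -
  have "k \<noteq> 0"
    using odd_k by (metis even_zero)
  then show ?thesis
    using power_two_power_gcd_fixed[OF assms frobenius_n] coprime_k idempotent_cases by simp
qed

lemma frobenius_2k_fixed:
  assumes "(x :: 'a) ^ (2 ^ (2 * k)) = x"
  shows "x ^ 4 = x"
proof -
  have "k \<noteq> 0"
    using odd_k by (metis even_zero)
  moreover have "gcd k m = 1"
    using coprime_k by (metis coprime_iff_gcd_eq_1 coprime_mult_right_iff)
  then have "gcd (2 * k) (2 * m) = 2"
    by (simp add: gcd_mult_distrib_nat[symmetric])
  ultimately show ?thesis
    using power_two_power_gcd_fixed[OF assms frobenius_n] by simp
qed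

text \<open>The evenness of \<open>m\<close> enters here: \<open>x ^ (2 ^ 2) = x\<close> is iterated
  \<open>m / 2\<close> times.\<close>

lemma F4_subset_K:
  assumes "(x :: 'a) ^ 4 = x"
  shows "x ^ (2 ^ m) = x"
proof -
  obtain j where "m = 2 * j"
    using even_m by blast
  then show ?thesis
    using power_two_power_mult_fixed[of x 2 j] assms by simp
qed

text \<open>Applying the map twice adds 1 twice, so \<open>x\<close> lies in the field of four
  elements, hence in \<open>K\<close>.\<close>

lemma frobenius_k_shift:
  assumes "(x :: 'a) ^ (2 ^ k) = x + 1"
  shows "x ^ (2 ^ m) = x"
proof -
  have "x ^ (2 ^ (2 * k)) = (x ^ (2 ^ k)) ^ (2 ^ k)"
    by (simp add: power_mult[symmetric] power_add[symmetric] mult_2)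
  also have "\<dots> = x"
    by (simp add: assms frobenius_add char2_simps add_ac)
  finally show ?thesis
    using frobenius_2k_fixed F4_subset_K by blast
qed

section \<open>Relative trace and the form of the derivatives\<close>

lemma rel_trace_in_K: "rel_trace (2 ^ m) (x :: 'a) ^ (2 ^ m) = rel_trace (2 ^ m) x"
  by (simp add: rel_trace_def frobenius_add frobenius_q_q add.commute)

lemma rel_trace_add: "rel_trace (2 ^ m) (x + y :: 'a) = rel_trace (2 ^ m) x + rel_trace (2 ^ m) y"
  by (simp add: rel_trace_def frobenius_add algebra_simps)

lemma rel_trace_mult_K:
  "(a :: 'a) ^ (2 ^ m) = a \<Longrightarrow> rel_trace (2 ^ m) (a * x) = a * rel_trace (2 ^ m) x"
  by (simp add: rel_trace_def power_mult_distrib algebra_simps)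

lemma rel_trace_K: "(a :: 'a) ^ (2 ^ m) = a \<Longrightarrow> rel_trace (2 ^ m) a = 0"
  by (simp add: rel_trace_def add_self)

lemma rel_trace_eq_0: "rel_trace (2 ^ m) (a :: 'a) = 0 \<longleftrightarrow> a ^ (2 ^ m) = a"
  by (auto simp add: rel_trace_def add_eq_0)

lemma frobenius_swap: "((x :: 'a) ^ (2 ^ i)) ^ (2 ^ j) = (x ^ (2 ^ j)) ^ (2 ^ i)"
  by (simp add: power_mult[symmetric] mult.commute)

text \<open>Transitivity of the trace: the upper half of the sum is the lower half taken at
  \<open>x ^ (2 ^ m)\<close>.\<close>

lemma abs_trace_tower: "abs_trace (2 * m) (x :: 'a) = abs_trace m (rel_trace (2 ^ m) x)"
proof -
  have "(\<Sum>i<m + j. x ^ (2 ^ i)) = (\<Sum>i<m. x ^ (2 ^ i)) + (\<Sum>i<j. (x ^ (2 ^ m)) ^ (2 ^ i))" for j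
    by (induction j) (simp_all add: power_add power_mult add.assoc)
  from this[of m] show ?thesis
    by (simp add: abs_trace_def rel_trace_def frobenius_add sum.distrib mult_2)
qed

text \<open>Terms in \<open>x\<close> alone or in \<open>A\<close> alone occur twice and cancel,
  leaving the mixed terms, which are additive in \<open>x\<close>.\<close>

lemma deriv2_fk:
  "deriv2 (fk (2 ^ m) k) A (x :: 'a) =
     x ^ (2 ^ k) * A + x * A ^ (2 ^ k)
     + rel_trace (2 ^ m) x ^ (2 ^ k) * rel_trace (2 ^ m) A
     + rel_trace (2 ^ m) x * rel_trace (2 ^ m) A ^ (2 ^ k)"
proof -
  have fk: "fk (2 ^ m) k y = y ^ (2 ^ k) * y + rel_trace (2 ^ m) y ^ (2 ^ k) * rel_trace (2 ^ m) y"
    for y :: 'a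
    by (simp add: fk_def rel_trace_def)
  show ?thesis
    unfolding deriv2_def fk rel_trace_add frobenius_add
    by (simp add: algebra_simps char2_simps)
qed

lemma deriv2_fk_add:
  "deriv2 (fk (2 ^ m) k) A (x + y :: 'a) = deriv2 (fk (2 ^ m) k) A x + deriv2 (fk (2 ^ m) k) A y"
  by (simp add: deriv2_fk rel_trace_add frobenius_add algebra_simps)

text \<open>For \<open>a\<close> in \<open>K\<close> the trace terms vanish. After scaling by
  \<open>a\<close> only \<open>y ^ \<sigma> + y\<close> remains, with kernel the prime field and
  absolute trace 0.\<close>

lemma range_deriv2_K:
  assumes "(a :: 'a) ^ (2 ^ m) = a" "a \<noteq> 0"
  shows "range (deriv2 (fk (2 ^ m) k) a) = hyperplane (2 * m) (1 / a ^ (2 ^ k + 1))"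
proof (rule range_eq_hyperplane)
  have D: "deriv2 (fk (2 ^ m) k) a x = a ^ (2 ^ k + 1) * ((x / a) ^ (2 ^ k) + x / a)" for x
    using assms by (simp add: deriv2_fk rel_trace_K power_divide field_simps zero_power)
  show "deriv2 (fk (2 ^ m) k) a (x + y) = deriv2 (fk (2 ^ m) k) a x + deriv2 (fk (2 ^ m) k) a y"
    for x y :: 'a
    by (rule deriv2_fk_add)
  show "x = 0 \<or> x = a" if "deriv2 (fk (2 ^ m) k) a x = 0" for x
  proof -
    have "(x / a) ^ (2 ^ k) = x / a"
      using that assms(2) by (simp add: D add_eq_0)
    then show ?thesis
      using frobenius_k_fixed[of "x / a"] assms(2) by simp
  qed
  show "abs_trace (2 * m) (1 / a ^ (2 ^ k + 1) * deriv2 (fk (2 ^ m) k) a x) = 0" for x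
    using assms(2)
    by (simp add: D abs_trace_add abs_trace_frobenius[OF frobenius_n] add_self)
qed (use assms in auto)

section \<open>Directions outside \<open>K\<close>\<close>

definition s :: "'a \<Rightarrow> 'a" where
  "s g = rel_trace (2 ^ m) (g ^ (2 ^ k + 1))"

definition c :: "'a \<Rightarrow> 'a" where
  "c g = rel_trace (2 ^ m) (g ^ 3)"

lemma trace_one_conj: "(g :: 'a) \<in> trace_one (2 ^ m) \<Longrightarrow> g ^ (2 ^ m) = g + 1"
  using add_left_self[of g "g ^ (2 ^ m)"] by (simp add: trace_one_def rel_trace_def)

context
  fixes g :: 'a
  assumes g: "g \<in> trace_one (2 ^ m)"
begin

lemma g_not_K: "g ^ (2 ^ m) \<noteq> g"
  by (simp add: trace_one_conj[OF g])

lemma s_eq: "s g = g ^ (2 ^ k) + g + 1"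
  using frobenius_swap[of g k m] trace_one_conj[OF g]
  by (simp add: s_def rel_trace_def power_mult_distrib frobenius_add algebra_simps char2_simps)

lemma c_eq: "c g = g * g + g + 1"
  using trace_one_conj[OF g]
  by (simp add: c_def rel_trace_def power_mult_distrib power3_eq_cube algebra_simps char2_simps)

lemma s_K: "s g ^ (2 ^ m) = s g"
  unfolding s_def by (rule rel_trace_in_K)

lemma c_K: "c g ^ (2 ^ m) = c g"
  unfolding c_def by (rule rel_trace_in_K)

lemma s_nonzero: "s g \<noteq> 0"
proof
  assume "s g = 0"
  then have "g ^ (2 ^ k) = g + 1"
    by (simp add: s_eq add_eq_0 add.assoc)
  then show False
    using frobenius_k_shift g_not_K by blast
qed

lemma c_nonzero: "c g \<noteq> 0"
proof
  assume "c g = 0"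
  then have "g * g = g + 1"
    by (simp add: c_eq add_eq_0 add.assoc)
  then have "g ^ 4 = g"
    by (simp add: numeral_eq_Suc algebra_simps char2_simps)
  then show False
    using F4_subset_K g_not_K by blast
qed

text \<open>With \<open>t = g ^ \<sigma> + g\<close> one has
  \<open>c g ^ \<sigma> + c g = t ^ 2 + t\<close>, which is unchanged when \<open>t\<close> is
  replaced by \<open>t + 1 = s g\<close>.\<close>

lemma c_frobenius: "c g ^ (2 ^ k) = c g + s g * s g + s g"
  by (simp add: s_eq c_eq frobenius_add power_mult_distrib algebra_simps char2_simps)

lemma beta_eq:
  "beta (2 ^ m) k a g = (s g * g + s g + c g) / (a ^ (2 ^ k + 1) * c g ^ (2 ^ k + 1))"
proof -
  have "s g * g + s g + c g = s g * (g + 1 + c g / s g)"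
    using s_nonzero by (simp add: field_simps)
  then show ?thesis
    unfolding beta_def s_def[symmetric] c_def[symmetric] by simp
qed

lemma basis_independent:
  assumes "p ^ (2 ^ m) = p" "r ^ (2 ^ m) = r" "p + r * g = 0"
  shows "p = 0 \<and> r = 0"
proof -
  have "rel_trace (2 ^ m) (p + r * g) = r"
    using assms(1,2) g by (simp add: rel_trace_add rel_trace_K rel_trace_mult_K trace_one_def)
  then have "r = 0"
    by (simp add: assms(3) rel_trace_K power_0_left)
  then show ?thesis
    using assms(3) by simp
qed

definition Z :: "'a \<Rightarrow> 'a" where
  "Z y = y ^ (2 ^ k) * g + y * g ^ (2 ^ k) + rel_trace (2 ^ m) y ^ (2 ^ k) + rel_trace (2 ^ m) y"

lemma basis_decomposition:
  obtains u v where "y = u + v * g" "u ^ (2 ^ m) = u" "v ^ (2 ^ m) = v" "rel_trace (2 ^ m) y = v"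
proof
  let ?v = "rel_trace (2 ^ m) y"
  show "y = (y + ?v * g) + ?v * g"
    by (simp add: add.assoc add_self)
  show "(y + ?v * g) ^ (2 ^ m) = y + ?v * g"
    by (simp add: frobenius_add power_mult_distrib rel_trace_in_K trace_one_conj[OF g])
      (simp add: rel_trace_def algebra_simps char2_simps)
qed (simp_all add: rel_trace_in_K)

text \<open>Substitute \<open>g ^ \<sigma> = g + s g + 1\<close> and
  \<open>g ^ 2 = g + c g + 1\<close>. The trace terms of \<open>Z\<close> cancel the summand 1 of
  \<open>g ^ (\<sigma> + 1) = c g + 1 + s g * g\<close>.\<close>

lemma Z_basis:
  assumes "rel_trace (2 ^ m) (u + v * g) = v"
  defines "w \<equiv> v ^ (2 ^ k) + v"
  shows "Z (u + v * g) = (u * (1 + s g) + w * c g) + (u ^ (2 ^ k) + u + w * s g) * g"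
  unfolding Z_def assms(1) w_def s_eq c_eq
  by (simp add: frobenius_add power_mult_distrib algebra_simps char2_simps)

lemma Z_kernel:
  assumes "Z y = 0"
  shows "y = 0 \<or> y = g"
proof -
  obtain u v where y: "y = u + v * g" and u: "u ^ (2 ^ m) = u" and v: "v ^ (2 ^ m) = v"
    and tr: "rel_trace (2 ^ m) y = v"
    by (rule basis_decomposition)
  define w where "w = v ^ (2 ^ k) + v"
  have w: "w ^ (2 ^ m) = w"
    using v by (simp add: w_def frobenius_add frobenius_swap[of v k m])
  have uk: "(u ^ (2 ^ k)) ^ (2 ^ m) = u ^ (2 ^ k)"
    using u by (simp add: frobenius_swap[of u k m])
  have "(u * (1 + s g) + w * c g) + (u ^ (2 ^ k) + u + w * s g) * g = 0"
    using assms Z_basis[of u v] tr by (simp add: y w_def)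
  then have "u * (1 + s g) + w * c g = 0 \<and> u ^ (2 ^ k) + u + w * s g = 0"
    by (intro basis_independent)
      (simp_all add: frobenius_add power_mult_distrib u uk w s_K c_K)
  then have e1: "w * c g = u * (1 + s g)" and e2: "u ^ (2 ^ k) + u + w * s g = 0"
    unfolding add_eq_0[of "u * (1 + s g)"] by simp_all
  show ?thesis
  proof (cases "u = 0")
    case True
    then have "w = 0"
      using e1 c_nonzero by simp
    then have "v = 0 \<or> v = 1"
      using frobenius_k_fixed by (simp add: w_def add_eq_0)
    then show ?thesis
      using True y by auto
  next
    case False
    \<comment> \<open>Multiplying the second coordinate equation by \<open>c g\<close> lets the
      first one eliminate \<open>w\<close>. By \<open>c_frobenius\<close> the result says that
      \<open>\<sigma>\<close> fixes \<open>u / c g\<close>.\<close>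
    have "c g * u ^ (2 ^ k) + c g * u + s g * (w * c g) = c g * (u ^ (2 ^ k) + u + w * s g)"
      by (simp add: algebra_simps)
    also have "\<dots> = 0"
      by (simp add: e2)
    finally have "c g * u ^ (2 ^ k) = c g * u + s g * (u * (1 + s g))"
      unfolding e1 add.assoc add_eq_0 .
    then have "c g * u ^ (2 ^ k) = u * c g ^ (2 ^ k)"
      unfolding c_frobenius by (simp add: algebra_simps)
    then have "(u / c g) ^ (2 ^ k) = u / c g"
      using c_nonzero by (simp add: power_divide field_simps)
    then have "u = c g"
      using frobenius_k_fixed[of "u / c g"] False c_nonzero by simp
    then have "w = 1 + s g"
      using e1 c_nonzero by simp
    then have "v ^ (2 ^ k) = v + (1 + s g)"
      unfolding w_def add_eq_iff .
    then have "(v + g) ^ (2 ^ k) = v + g"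
      by (simp add: s_eq frobenius_add algebra_simps char2_simps)
    \<comment> \<open>Neither value lies in \<open>K\<close>, but \<open>v\<close> does, so this
      case is contradictory.\<close>
    then have "v = g \<or> v = g + 1"
      using frobenius_k_fixed[of "v + g"] unfolding add_eq_iff by simp
    then show ?thesis
      using v g_not_K by (auto simp: frobenius_add)
  qed
qed

lemma Z_trace: "abs_trace (2 * m) ((s g * g + s g + c g) / c g ^ (2 ^ k + 1) * Z y) = 0"
proof -
  obtain u v where y: "y = u + v * g" and u: "u ^ (2 ^ m) = u" and v: "v ^ (2 ^ m) = v"
    and tr: "rel_trace (2 ^ m) y = v"
    by (rule basis_decomposition)
  define w where "w = v ^ (2 ^ k) + v"
  \<comment> \<open>\<open>p\<close> and \<open>r\<close> are the coordinates of
    \<open>(s g * g + s g + c g) * Z y\<close> in the basis \<open>1, g\<close>. For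
    \<open>p\<close> only membership in \<open>K\<close> matters, since the relative trace removes
    it.\<close>
  define p where "p = (s g * u ^ (2 ^ k) + s g * u + s g * s g * w) * (c g + 1)
     + (s g + c g) * (u * (1 + s g) + w * c g)"
  define r where "r = c g * u ^ (2 ^ k) + u * c g ^ (2 ^ k)"
  define N where "N = c g ^ (2 ^ k + 1)"
  have w: "w ^ (2 ^ m) = w"
    using v by (simp add: w_def frobenius_add frobenius_swap[of v k m])
  have uk: "(u ^ (2 ^ k)) ^ (2 ^ m) = u ^ (2 ^ k)"
    using u by (simp add: frobenius_swap[of u k m])
  have ck: "(c g ^ (2 ^ k)) ^ (2 ^ m) = c g ^ (2 ^ k)"
    using c_K by (simp add: frobenius_swap[of "c g" k m])
  have "Z y = (u * (1 + s g) + w * c g) + (u ^ (2 ^ k) + u + w * s g) * g"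
    using Z_basis[of u v] tr by (simp add: y w_def)
  then have "(s g * g + s g + c g) * Z y = p + r * g"
    unfolding p_def r_def c_frobenius unfolding c_eq by (simp add: algebra_simps char2_simps)
  then have "(s g * g + s g + c g) / N * Z y = p / N + (r / N) * g"
    by (simp add: add_divide_distrib[symmetric])
  also have "rel_trace (2 ^ m) \<dots> = r / N"
  proof -
    have "N ^ (2 ^ m) = N" "p ^ (2 ^ m) = p" "r ^ (2 ^ m) = r"
      unfolding N_def p_def r_def
      by (simp_all add: frobenius_add power_mult_distrib u uk w s_K c_K ck)
    then show ?thesis
      using g rel_trace_mult_K[of "r / N" g]
      by (simp add: rel_trace_add rel_trace_K trace_one_def power_divide)
  qed
  also have "r / N = (u / c g) ^ (2 ^ k) + u / c g"
    using c_nonzero by (simp add: r_def N_def power_divide field_simps)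
  finally have "abs_trace (2 * m) ((s g * g + s g + c g) / N * Z y)
      = abs_trace m ((u / c g) ^ (2 ^ k) + u / c g)"
    by (simp add: abs_trace_tower)
  also have "\<dots> = 0"
    using u c_K by (simp add: abs_trace_add abs_trace_frobenius power_divide[of u "c g" "2 ^ m"] add_self)
  finally show ?thesis
    by (simp add: N_def)
qed

lemma beta_nonzero:
  assumes "a \<noteq> 0"
  shows "beta (2 ^ m) k a g \<noteq> 0"
proof -
  have "s g * g + s g + c g \<noteq> 0"
    using basis_independent[of "s g + c g" "s g"] s_nonzero
    by (auto simp: frobenius_add s_K c_K add_ac)
  then show ?thesis
    using assms c_nonzero by (simp add: beta_eq)
qed

lemma range_deriv2_trace_one:
  assumes a: "a ^ (2 ^ m) = a" "a \<noteq> 0"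
  shows "range (deriv2 (fk (2 ^ m) k) (a * g)) = hyperplane (2 * m) (beta (2 ^ m) k a g)"
proof (rule range_eq_hyperplane)
  have D: "deriv2 (fk (2 ^ m) k) (a * g) x = a ^ (2 ^ k + 1) * Z (x / a)" for x
  proof -
    have "rel_trace (2 ^ m) (a * g) = a"
      using a g by (simp add: rel_trace_mult_K trace_one_def)
    moreover have "rel_trace (2 ^ m) x = a * rel_trace (2 ^ m) (x / a)"
      using rel_trace_mult_K[OF a(1), of "x / a"] a(2) by simp
    moreover have "x ^ (2 ^ k) = a ^ (2 ^ k) * (x / a) ^ (2 ^ k)" "x = a * (x / a)"
      using a(2) by (simp_all add: power_divide)
    ultimately show ?thesis
      unfolding deriv2_fk Z_def
      by (simp add: power_mult_distrib distrib_left mult_ac)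
  qed
  show "deriv2 (fk (2 ^ m) k) (a * g) (x + y)
      = deriv2 (fk (2 ^ m) k) (a * g) x + deriv2 (fk (2 ^ m) k) (a * g) y" for x y
    by (rule deriv2_fk_add)
  show "x = 0 \<or> x = a * g" if "deriv2 (fk (2 ^ m) k) (a * g) x = 0" for x
  proof -
    have "Z (x / a) = 0"
      using that a(2) by (simp add: D)
    then have "x / a = 0 \<or> x / a = g"
      by (rule Z_kernel)
    then show ?thesis
      using a(2) by (auto simp: field_simps)
  qed
  show "abs_trace (2 * m) (beta (2 ^ m) k a g * deriv2 (fk (2 ^ m) k) (a * g) x) = 0" for x
    using Z_trace[of "x / a"] a(2) by (simp add: D beta_eq)
qed (rule beta_nonzero[OF a(2)])

lemma rel_trace_beta:
  assumes "a ^ (2 ^ m) = a"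
  shows "rel_trace (2 ^ m) (beta (2 ^ m) k a g) = s g / (a ^ (2 ^ k + 1) * c g ^ (2 ^ k + 1))"
proof -
  define N where "N = a ^ (2 ^ k + 1) * c g ^ (2 ^ k + 1)"
  have "N ^ (2 ^ m) = N"
    using assms frobenius_swap[of a k m] frobenius_swap[of "c g" k m]
    by (simp add: N_def power_mult_distrib c_K)
  moreover have "beta (2 ^ m) k a g = (s g + c g) / N + s g / N * g"
    by (simp add: beta_eq N_def add_divide_distrib[symmetric] add_ac)
  ultimately show ?thesis
    using g rel_trace_mult_K[of "s g / N" g] unfolding N_def[symmetric]
    by (simp add: rel_trace_add rel_trace_K trace_one_def power_divide s_K c_K frobenius_add)
qed

text \<open>The quotient no longer involves \<open>a\<close>, so \<open>g\<close> can be recovered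
  before \<open>a\<close>.\<close>

lemma beta_normalized:
  assumes "a ^ (2 ^ m) = a" "a \<noteq> 0"
  shows "beta (2 ^ m) k a g / rel_trace (2 ^ m) (beta (2 ^ m) k a g) = g + 1 + c g / s g"
proof -
  define N where "N = a ^ (2 ^ k + 1) * c g ^ (2 ^ k + 1)"
  have "N \<noteq> 0"
    using assms(2) c_nonzero by (simp add: N_def)
  then show ?thesis
    using s_nonzero unfolding rel_trace_beta[OF assms(1)] unfolding beta_eq N_def[symmetric]
    by (simp add: field_simps)
qed

end

section \<open>The hyperplane spectrum\<close>

lemma normalized_inject:
  assumes g: "(g :: 'a) \<in> trace_one (2 ^ m)" and h: "h \<in> trace_one (2 ^ m)"
    and eq: "g + 1 + c g / s g = h + 1 + c h / s h"
  shows "g = h"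
proof (rule ccontr)
  assume "g \<noteq> h"
  define r where "r = g + h"
  have r0: "r \<noteq> 0"
    using \<open>g \<noteq> h\<close> by (simp add: r_def add_eq_0)
  have rK: "r ^ (2 ^ m) = r"
    by (simp add: r_def frobenius_add trace_one_conj g h algebra_simps char2_simps)
  have h_eq: "h = g + r"
    by (simp add: r_def add_left_self)
  have ch: "c h = c g + r * r + r"
    by (simp add: c_eq g h) (simp add: h_eq algebra_simps char2_simps)
  have sh: "s h = s g + r ^ (2 ^ k) + r"
    by (simp add: s_eq g h) (simp add: h_eq frobenius_add algebra_simps char2_simps)
  have "c g / s g = r + c h / s h"
    using eq by (simp add: h_eq add_ac)
  then have eq': "c g * s h = s g * (r * s h + c h)"
    using s_nonzero[OF g] s_nonzero[OF h] by (simp add: field_simps)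
  \<comment> \<open>Over the denominator \<open>r * r ^ \<sigma>\<close> the numerator is the sum of
    the two sides of \<open>eq'\<close>, hence 0.\<close>
  have "(c g / r) ^ (2 ^ k) + c g / r + s g
      = (r * (c g ^ (2 ^ k) + s g * r ^ (2 ^ k)) + c g * r ^ (2 ^ k)) / (r * r ^ (2 ^ k))"
    using r0 by (simp add: power_divide field_simps)
  also have "r * (c g ^ (2 ^ k) + s g * r ^ (2 ^ k)) + c g * r ^ (2 ^ k)
      = c g * s h + s g * (r * s h + c h)"
    unfolding ch sh c_frobenius[OF g] by (simp add: algebra_simps char2_simps)
  also have "\<dots> = 0"
    unfolding eq' by (rule add_self)
  finally have "(c g / r) ^ (2 ^ k) + c g / r = s g"
    by (simp add: add_eq_0)
  then have "(c g / r) ^ (2 ^ k) = c g / r + s g"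
    unfolding add_eq_iff .
  then have "(g + c g / r) ^ (2 ^ k) = (g + c g / r) + 1"
    by (simp add: s_eq[OF g] frobenius_add algebra_simps char2_simps)
  then have "(g + c g / r) ^ (2 ^ m) = g + c g / r"
    by (rule frobenius_k_shift)
  then have "g ^ (2 ^ m) = g"
    by (simp add: frobenius_add power_divide c_K[OF g] rK)
  then show False
    using g_not_K[OF g] by blast
qed

text \<open>If \<open>x ^ \<sigma>\<close> is the inverse of \<open>x\<close>, then applying
  \<open>\<sigma>\<close> twice fixes \<open>x\<close>, which puts \<open>x\<close> in the field of
  four elements. Conversely, an odd power of Frobenius acts on that field as squaring.\<close>

lemma power_gold_eq_iff:
  assumes "(x :: 'a) \<noteq> 0"
  shows "x ^ (2 ^ k + 1) = 1 \<longleftrightarrow> x ^ 3 = 1"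
proof
  assume "x ^ (2 ^ k + 1) = 1"
  then have "x ^ (2 ^ k) = inverse x"
    using assms by (simp add: inverse_unique)
  then have "x ^ (2 ^ (2 * k)) = x"
    by (simp add: mult_2 power_add power_mult power_inverse)
  then have "x ^ 3 * x = 1 * x"
    using frobenius_2k_fixed[of x] by (simp add: power_Suc2[symmetric] del: power_Suc)
  then show "x ^ 3 = 1"
    using assms by simp
next
  assume x: "x ^ 3 = 1"
  obtain j where "k = 2 * j + 1"
    using odd_k by (elim oddE)
  then have "x ^ (2 ^ k) = (x ^ (2 ^ (2 * j))) ^ 2"
    by (metis power_add power_mult power_one_right)
  also have "x ^ (2 ^ (2 * j)) = x"
  proof (rule power_two_power_mult_fixed)
    have "x ^ 4 = x ^ 3 * x"
      by (simp add: numeral_eq_Suc)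
    then show "x ^ (2 ^ 2) = x"
      by (simp add: x)
  qed
  finally show "x ^ (2 ^ k + 1) = 1"
    using x by (simp add: numeral_eq_Suc)
qed

text \<open>A primitive cube root of unity solves \<open>w ^ (2 ^ k) + w = 1\<close>, which is soluble because \<open>1\<close> has
  absolute trace \<open>2 m = 0\<close> and so lies in the image of the derivative in direction \<open>1\<close>.\<close>

lemma card_cube_roots_of_unity: "card {x :: 'a. x ^ 3 = 1} = 3"
proof -
  have "(\<Sum>i<2 * j. 1 :: 'a) = 0" for j :: nat
    by (induction j) (simp_all add: char2_simps)
  then have "(1 :: 'a) \<in> hyperplane (2 * m) (1 / 1 ^ (2 ^ k + 1))"
    by (simp add: hyperplane_def abs_trace_def del: sum_constant)
  then have "(1 :: 'a) \<in> range (deriv2 (fk (2 ^ m) k) 1)"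
    using range_deriv2_K[of 1] by simp
  then obtain w :: 'a where "1 = deriv2 (fk (2 ^ m) k) 1 w"
    by blast
  then have w: "w ^ (2 ^ k) = w + 1"
    by (simp add: deriv2_fk rel_trace_def add_self add_eq_iff zero_power)
  have "w ^ (2 ^ (2 * k)) = w"
    by (simp add: mult_2 power_add power_mult w frobenius_add char2_simps add_ac)
  then have w4: "w ^ 4 = w"
    by (rule frobenius_2k_fixed)
  have w01: "w \<noteq> 0" "w \<noteq> 1"
    using w by (auto simp: zero_power char2_simps)
  have "w * (w + 1) * (w * w + w + 1) = w ^ 4 + w"
    by (simp add: numeral_eq_Suc algebra_simps char2_simps)
  then have ww: "w * w = w + 1"
    using w4 w01 by (simp add: add_self add_eq_0 add.assoc)
  have "x ^ 3 = 1 \<longleftrightarrow> x = 1 \<or> x = w \<or> x = w + 1" for x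
  proof -
    have "(x + 1) * ((x + w) * (x + (w + 1))) = x ^ 3 + 1"
      by (simp add: numeral_eq_Suc algebra_simps char2_simps ww)
    then show ?thesis
      by (metis add_eq_0 mult_eq_0_iff)
  qed
  then have "{x. x ^ 3 = 1} = {1, w, w + 1}"
    by auto
  then show ?thesis
    using w01 by simp
qed

section \<open>The hyperplane attached to an arbitrary direction\<close>

definition beta_of :: "'a \<Rightarrow> 'a" where
  "beta_of A = (if A ^ (2 ^ m) = A then 1 / A ^ (2 ^ k + 1)
     else beta (2 ^ m) k (rel_trace (2 ^ m) A) (A / rel_trace (2 ^ m) A))"

text \<open>Since \<open>Tr(a g) = a\<close> for \<open>a\<close> in \<open>K\<close>, the
  decomposition \<open>A = a g\<close> is explicit, and \<open>beta_of\<close> involves no choice of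
  \<open>a\<close> and \<open>g\<close>.\<close>

lemma normalize_trace_one:
  assumes "(A :: 'a) ^ (2 ^ m) \<noteq> A"
  shows "A / rel_trace (2 ^ m) A \<in> trace_one (2 ^ m)" "rel_trace (2 ^ m) A \<noteq> 0"
proof -
  show t: "rel_trace (2 ^ m) A \<noteq> 0"
    using assms by (simp add: rel_trace_eq_0)
  show "A / rel_trace (2 ^ m) A \<in> trace_one (2 ^ m)"
    using rel_trace_mult_K[of "1 / rel_trace (2 ^ m) A" A] t
    by (simp add: trace_one_def power_divide rel_trace_in_K)
qed

lemma beta_of:
  assumes "A \<noteq> 0"
  shows "beta_of A \<noteq> 0" "range (deriv2 (fk (2 ^ m) k) A) = hyperplane (2 * m) (beta_of A)"
proof -
  show "beta_of A \<noteq> 0"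
    using assms normalize_trace_one[of A] beta_nonzero by (auto simp: beta_of_def)
  show "range (deriv2 (fk (2 ^ m) k) A) = hyperplane (2 * m) (beta_of A)"
  proof (cases "A ^ (2 ^ m) = A")
    case True
    then show ?thesis
      using range_deriv2_K assms by (simp add: beta_of_def)
  next
    case False
    then show ?thesis
      using range_deriv2_trace_one[OF normalize_trace_one(1)[OF False] rel_trace_in_K[of A]]
        normalize_trace_one(2)[OF False] by (simp add: beta_of_def)
  qed
qed

text \<open>Distinct nonzero \<open>b\<close> give distinct hyperplanes, so each \<open>THE\<close>
  in \<open>hyperplane_spectrum\<close> evaluates to \<open>beta_of\<close>.\<close>

lemma beta_of_unique:
  assumes "A \<noteq> 0"
  shows "b \<noteq> 0 \<and> range (deriv2 (fk (2 ^ m) k) A) = hyperplane (2 * m) b \<longleftrightarrow> b = beta_of A"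
  using beta_of[OF assms] hyperplane_inject by auto

text \<open>Together with \<open>beta_of_K\<close> this lets the trace of \<open>beta_of A\<close>
  detect whether \<open>A\<close> lies in \<open>K\<close>, so directions inside and outside
  \<open>K\<close> share no hyperplane.\<close>

lemma rel_trace_beta_of_nonzero:
  assumes "A ^ (2 ^ m) \<noteq> A"
  shows "rel_trace (2 ^ m) (beta_of A) \<noteq> 0"
  using assms normalize_trace_one[OF assms]
  by (simp add: beta_of_def rel_trace_beta rel_trace_in_K s_nonzero c_nonzero)

lemma beta_of_K:
  assumes "A ^ (2 ^ m) = A"
  shows "rel_trace (2 ^ m) (beta_of A) = 0"
  using assms frobenius_swap[of A k m]
  by (simp add: beta_of_def rel_trace_eq_0 power_divide power_mult_distrib)

text \<open>Cube roots of unity lie in \<open>K\<close>, so outside \<open>K\<close> the factor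
  \<open>w\<close> changes only \<open>a\<close>, and in both cases it enters only through
  \<open>w ^ (\<sigma> + 1) = 1\<close>.\<close>

lemma beta_of_cube_root:
  assumes "w ^ 3 = 1"
  shows "beta_of (A * w) = beta_of A"
proof -
  have w0: "w \<noteq> 0"
    using assms by auto
  have wk: "w ^ (2 ^ k + 1) = 1"
    using power_gold_eq_iff[OF w0] assms by simp
  have "w ^ 4 = w ^ 3 * w"
    by (simp add: numeral_eq_Suc)
  then have wK: "w ^ (2 ^ m) = w"
    using F4_subset_K assms by simp
  have "rel_trace (2 ^ m) (A * w) = w * rel_trace (2 ^ m) A"
    using rel_trace_mult_K[OF wK, of A] by (simp add: mult.commute)
  then show ?thesis
    using w0 wk wK by (simp add: beta_of_def beta_def power_mult_distrib mult_ac)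
qed

text \<open>Outside \<open>K\<close>, the normalized values first give the same \<open>g\<close>;
  comparing relative traces then equates the powers \<open>\<sigma> + 1\<close> of the two
  \<open>K\<close>-factors.\<close>

lemma beta_of_eq_imp:
  assumes "A \<noteq> 0" "B \<noteq> 0" "beta_of A = beta_of B"
  shows "(A / B) ^ 3 = 1"
proof (cases "A ^ (2 ^ m) = A")
  case True
  then have "B ^ (2 ^ m) = B"
    using beta_of_K rel_trace_beta_of_nonzero assms(3) by metis
  then have "A ^ (2 ^ k + 1) = B ^ (2 ^ k + 1)"
    using True assms by (simp add: beta_of_def field_simps)
  then have "(A / B) ^ (2 ^ k + 1) = 1"
    unfolding power_divide using assms by simp
  then show ?thesis
    using power_gold_eq_iff[of "A / B"] assms by simp
next
  case False
  then have B: "B ^ (2 ^ m) \<noteq> B"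
    using beta_of_K rel_trace_beta_of_nonzero assms(3) by metis
  let ?a = "rel_trace (2 ^ m) A" and ?b = "rel_trace (2 ^ m) B"
  have g: "A / ?a \<in> trace_one (2 ^ m)" and a: "?a \<noteq> 0"
    using normalize_trace_one[OF False] by auto
  have h: "B / ?b \<in> trace_one (2 ^ m)" and b: "?b \<noteq> 0"
    using normalize_trace_one[OF B] by auto
  have eq: "beta (2 ^ m) k ?a (A / ?a) = beta (2 ^ m) k ?b (B / ?b)"
    using assms(3) False B by (simp add: beta_of_def)
  have gh: "A / ?a = B / ?b"
    using normalized_inject[OF g h] beta_normalized[OF g rel_trace_in_K a]
      beta_normalized[OF h rel_trace_in_K b] eq by simp
  have "s (B / ?b) / (?a ^ (2 ^ k + 1) * c (B / ?b) ^ (2 ^ k + 1))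
      = s (B / ?b) / (?b ^ (2 ^ k + 1) * c (B / ?b) ^ (2 ^ k + 1))"
    using rel_trace_beta[OF g rel_trace_in_K] rel_trace_beta[OF h rel_trace_in_K] eq gh by metis
  then have "?a ^ (2 ^ k + 1) = ?b ^ (2 ^ k + 1)"
    using a b s_nonzero[OF h] c_nonzero[OF h] by (simp add: field_simps)
  then have "(?a / ?b) ^ (2 ^ k + 1) = 1"
    unfolding power_divide using b by simp
  then have "(?a / ?b) ^ 3 = 1"
    using power_gold_eq_iff[of "?a / ?b"] a b by simp
  moreover have "A / B = ?a / ?b"
    using gh a b assms by (simp add: field_simps)
  ultimately show ?thesis
    by simp
qed

lemma card_beta_of_fibre:
  assumes "B \<noteq> 0"
  shows "card {A \<in> UNIV - {0}. beta_of A = beta_of B} = 3"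
proof -
  have "{A \<in> UNIV - {0}. beta_of A = beta_of B} = (*) B ` {w. w ^ 3 = 1}"
  proof (intro equalityI subsetI)
    fix A assume "A \<in> {A \<in> UNIV - {0}. beta_of A = beta_of B}"
    then have "(A / B) ^ 3 = 1"
      using beta_of_eq_imp assms by blast
    moreover have "A = B * (A / B)"
      using assms by simp
    ultimately show "A \<in> (*) B ` {w. w ^ 3 = 1}"
      by blast
  next
    fix A assume "A \<in> (*) B ` {w. w ^ 3 = 1}"
    then show "A \<in> {A \<in> UNIV - {0}. beta_of A = beta_of B}"
      using assms beta_of_cube_root by auto
  qed
  moreover have "inj_on ((*) B) X" for X
    using assms by (simp add: inj_on_def)
  ultimately show ?thesis
    by (simp add: card_image card_cube_roots_of_unity)
qed

lemma hyperplane_derivs_fk: "hyperplane_derivs (2 * m) (fk (2 ^ m) k :: 'a \<Rightarrow> 'a)"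
  by (simp add: hyperplane_derivs_def beta_of_unique)

lemma hyperplane_spectrum_fk:
  "hyperplane_spectrum (2 * m) (fk (2 ^ m) k) = image_mset beta_of (mset_set (UNIV - {0}))"
  unfolding hyperplane_spectrum_def
  by (rule image_mset_cong) (simp add: beta_of_unique)

lemma count_hyperplane_spectrum:
  assumes "b \<in># hyperplane_spectrum (2 * m) (fk (2 ^ m) k :: 'a \<Rightarrow> 'a)"
  shows "count (hyperplane_spectrum (2 * m) (fk (2 ^ m) k)) b = 3"
proof -
  obtain B where B: "B \<noteq> 0" "b = beta_of B"
    using assms by (auto simp: hyperplane_spectrum_fk)
  have "count (hyperplane_spectrum (2 * m) (fk (2 ^ m) k)) b
      = card {A \<in> UNIV - {0}. beta_of A = beta_of B}"
    unfolding hyperplane_spectrum_fk B(2) count_image_mset'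
    by (simp add: eq_commute[of "beta_of B"])
  then show ?thesis
    using card_beta_of_fibre[OF B(1)] by simp
qed

end

theorem theorem4:
  fixes m n q k :: nat
  assumes "even m" and "m > 0" and "n = 2 * m" and "q = 2 ^ m"
    and "card (UNIV :: 'a::{field,finite} set) = 2 ^ n"
    and "k > 0" and "gcd k n = 1"
  shows "(\<forall>A a g :: 'a. a \<in> subfield_of_order q - {0} \<and> g \<in> trace_one q \<and> A = a * g \<longrightarrow>
            beta q k a g \<noteq> 0 \<and> range (deriv2 (fk q k) A) = hyperplane n (beta q k a g))
       \<and> hyperplane_derivs n (fk q k :: 'a \<Rightarrow> 'a)
       \<and> (\<forall>\<beta> \<in># hyperplane_spectrum n (fk q k :: 'a \<Rightarrow> 'a).
            count (hyperplane_spectrum n (fk q k :: 'a \<Rightarrow> 'a)) \<beta> = 3)"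
proof -
  interpret gold_parameters m "TYPE('a)" k
    using assms by unfold_locales simp_all
  show ?thesis
    using range_deriv2_trace_one beta_nonzero hyperplane_derivs_fk count_hyperplane_spectrum
    by (simp add: assms(3,4) subfield_of_order_def)
qed

end
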